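(* Let $(T_0,\widetilde T_0)$ be a joint pair of abstract Friedrichs operators on a complex Hilbert space $\mathcal{H}$ and let $\mathcal{V}$ be a subspace of the graph space $\mathcal{W}$ satisfying condition (V). Put $\widetilde{\mathcal{V}}:=\mathcal{V}^{[\perp]}$. Then for any sequences $(u_n)_n$ in $\mathcal{V}$ and $(v_n)_n$ in $\widetilde{\mathcal{V}}$ that converge weakly in $\mathcal{W}$, with weak limits $u\in\mathcal{V}$ and $v\in\widetilde{\mathcal{V}}$ respectively (i.e. $u_n\rightharpoonup u$ and $v_n\rightharpoonup v$ in $\mathcal{W}$), we have $$\liminf_{n\to\infty}\,[\,u_n\mid u_n\,]\ \ge\ [\,u\mid u\,],\qquad \limsup_{n\to\infty}\,[\,v_n\mid v_n\,]\ \le\ [\,v\mid v\,].$$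
   Context: The scalar product $\langle\,\cdot\mid\cdot\,\rangle$ of $\mathcal{H}$ is anti-linear in the second entry, with norm $\|\cdot\|$. A pair $(T_0,\widetilde T_0)$ of linear operators on $\mathcal{H}$ is a joint pair of abstract Friedrichs operators if: (T1) $T_0$ and $\widetilde T_0$ have a common domain $\mathcal{D}$, dense in $\mathcal{H}$, and $\langle T_0\phi\mid\psi\rangle=\langle\phi\mid\widetilde T_0\psi\rangle$ for all $\phi,\psi\in\mathcal{D}$; (T2) there is $\lambda>0$ with $\|(T_0+\widetilde T_0)\phi\|\le 2\lambda\|\phi\|$ for all $\phi\in\mathcal{D}$; (T3) there is $\mu>0$ with $\langle(T_0+\widetilde T_0)\phi\mid\phi\rangle\ge 2\mu\|\phi\|^2$ for all $\phi\in\mathcal{D}$. Put $T_1:=\widetilde T_0^{*}$ and $\widetilde T_1:=T_0^{*}$ (Hilbert space adjoints). It is known that $\operatorname{dom}T_1=\operatorname{dom}\widetilde T_1=:\mathcal{W}$ (the graph space). The space $\mathcal{W}$ is equipped with the graph norm $\|u\|_{T_1}=\|u\|+\|T_1u\|$, which is equivalent to the norm induced by the inner product $\langle u\mid v\rangle+\langle T_1u\mid T_1v\rangle$, with which $\mathcal{W}$ is a Hilbert space; weak convergence in $\mathcal{W}$ refers to this structure (equivalently, $u_n\rightharpoonup u$ and $T_1u_n\rightharpoonup T_1u$ weakly in $\mathcal{H}$). Indefinite inner product on $\mathcal{W}$: $[\,u\mid v\,]:=\langle T_1u\mid v\rangle-\langle u\mid\widetilde T_1v\rangle$ for $u,v\in\mathcal{W}$;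 it is a Hermitian form, so $[\,u\mid u\,]$ is real. For $S\subseteq\mathcal{W}$, $S^{[\perp]}:=\{u\in\mathcal{W}:[\,u\mid v\,]=0\text{ for all }v\in S\}$, which is closed in $\mathcal{W}$. Condition (V) for a subspace $\mathcal{V}\subseteq\mathcal{W}$: with $\widetilde{\mathcal{V}}:=\mathcal{V}^{[\perp]}$ one has $\mathcal{V}=\widetilde{\mathcal{V}}^{[\perp]}$, and $[\,u\mid u\,]\ge 0$ for all $u\in\mathcal{V}$, $[\,v\mid v\,]\le 0$ for all $v\in\widetilde{\mathcal{V}}$. *)

theory Defs
  imports "HOL-Analysis.Analysis"
begin

text \<open>
  The libraries only provide real inner product spaces. In the class below \<open>cinner\<close> is linear in
  the first and anti-linear in the second argument. Positive definiteness follows from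
  \<open>norm_eq_sqrt_cinner\<close> and the norm axioms, since \<open>sqrt\<close> is odd and injective on the reals.
\<close>

class complex_inner = real_normed_vector +
  fixes scaleC :: "complex \<Rightarrow> 'a \<Rightarrow> 'a"  (infixr "*\<^sub>C" 75)
    and cinner :: "'a \<Rightarrow> 'a \<Rightarrow> complex"
  assumes scaleC_add_right: "c *\<^sub>C (x + y) = c *\<^sub>C x + c *\<^sub>C y"
    and scaleC_add_left: "(c + d) *\<^sub>C x = c *\<^sub>C x + d *\<^sub>C x"
    and scaleC_scaleC: "c *\<^sub>C d *\<^sub>C x = (c * d) *\<^sub>C x"
    and scaleR_scaleC: "r *\<^sub>R x = complex_of_real r *\<^sub>C x"
    and cinner_add_left: "cinner (x + y) z = cinner x z + cinner y z"
    and cinner_scaleC_left: "cinner (c *\<^sub>C x) y = c * cinner x y"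
    and cinner_commute: "cinner x y = cnj (cinner y x)"
    and norm_eq_sqrt_cinner: "norm x = sqrt (Re (cinner x x))"

class chilbert_space = complex_inner + complete_space

lemma vector_space_scaleC: "vector_space (scaleC :: complex \<Rightarrow> 'a \<Rightarrow> 'a::complex_inner)"
proof
  fix x :: 'a
  show "1 *\<^sub>C x = x"
    using scaleR_scaleC[of 1 x] by simp
qed (simp_all add: scaleC_add_right scaleC_add_left scaleC_scaleC)

instantiation complex :: chilbert_space
begin

definition scaleC_complex :: "complex \<Rightarrow> complex \<Rightarrow> complex"
  where "scaleC_complex c x = c * x"

definition cinner_complex :: "complex \<Rightarrow> complex \<Rightarrow> complex"
  where "cinner_complex x y = x * cnj y"

instance
  by standard
    (simp_all add: scaleC_complex_def cinner_complex_def algebra_simps scaleR_conv_of_real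
      cmod_def power2_eq_square)

end

abbreviation csubspace :: "'h::complex_inner set \<Rightarrow> bool"
  where "csubspace \<equiv> module.subspace scaleC"

text \<open>
  A not necessarily everywhere defined operator is a partial map, so that \<open>dom T\<close> is its domain.
\<close>

type_synonym 'h pop = "'h \<Rightarrow> 'h option"

abbreviation op_app :: "'h pop \<Rightarrow> 'h \<Rightarrow> 'h"  (infixr "\<bullet>\<^sub>o" 90)
  where "T \<bullet>\<^sub>o u \<equiv> the (T u)"

definition linear_operator :: "'h::complex_inner pop \<Rightarrow> bool"
  where "linear_operator T \<longleftrightarrow>
    csubspace (dom T) \<and>
    (\<forall>u\<in>dom T. \<forall>v\<in>dom T. T \<bullet>\<^sub>o (u + v) = T \<bullet>\<^sub>o u + T \<bullet>\<^sub>o v) \<and>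
    (\<forall>c. \<forall>u\<in>dom T. T \<bullet>\<^sub>o (c *\<^sub>C u) = c *\<^sub>C (T \<bullet>\<^sub>o u))"

text \<open>The vector described by \<open>THE\<close> is unique whenever \<open>dom T\<close> is dense.\<close>

definition op_adjoint :: "'h::complex_inner pop \<Rightarrow> 'h pop"
  where "op_adjoint T = (\<lambda>v.
    if \<exists>w. \<forall>u\<in>dom T. cinner (T \<bullet>\<^sub>o u) v = cinner u w
    then Some (THE w. \<forall>u\<in>dom T. cinner (T \<bullet>\<^sub>o u) v = cinner u w)
    else None)"

text \<open>
  In the last condition \<open>Re\<close> loses nothing: the scalar product there is real by the symmetry
  condition relating \<open>T0\<close> and \<open>T0'\<close>.
\<close>

definition joint_friedrichs_pair :: "'h::complex_inner pop \<Rightarrow> 'h pop \<Rightarrow> bool"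
  where "joint_friedrichs_pair T0 T0' \<longleftrightarrow>
    linear_operator T0 \<and> linear_operator T0' \<and>
    dom T0 = dom T0' \<and> closure (dom T0) = UNIV \<and>
    (\<forall>\<phi>\<in>dom T0. \<forall>\<psi>\<in>dom T0. cinner (T0 \<bullet>\<^sub>o \<phi>) \<psi> = cinner \<phi> (T0' \<bullet>\<^sub>o \<psi>)) \<and>
    (\<exists>l>0. \<forall>\<phi>\<in>dom T0. norm (T0 \<bullet>\<^sub>o \<phi> + T0' \<bullet>\<^sub>o \<phi>) \<le> 2 * l * norm \<phi>) \<and>
    (\<exists>m>0. \<forall>\<phi>\<in>dom T0. Re (cinner (T0 \<bullet>\<^sub>o \<phi> + T0' \<bullet>\<^sub>o \<phi>) \<phi>) \<ge> 2 * m * (norm \<phi>)\<^sup>2)"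

text \<open>
  Below, \<open>T1\<close> is the adjoint of \<open>T0'\<close> and \<open>T1'\<close> the adjoint of \<open>T0\<close>. For a joint pair both have
  the same domain.
\<close>

definition graph_space :: "'h::complex_inner pop \<Rightarrow> 'h pop \<Rightarrow> 'h set"
  where "graph_space T0 T0' = dom (op_adjoint T0')"

definition graph_norm :: "'h::complex_inner pop \<Rightarrow> 'h pop \<Rightarrow> 'h \<Rightarrow> real"
  where "graph_norm T0 T0' u = norm u + norm (op_adjoint T0' \<bullet>\<^sub>o u)"

definition graph_dual :: "'h::complex_inner pop \<Rightarrow> 'h pop \<Rightarrow> ('h \<Rightarrow> complex) set"
  where "graph_dual T0 T0' = {f.
    (\<forall>u\<in>graph_space T0 T0'. \<forall>v\<in>graph_space T0 T0'. f (u + v) = f u + f v) \<and>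
    (\<forall>c. \<forall>u\<in>graph_space T0 T0'. f (c *\<^sub>C u) = c * f u) \<and>
    (\<exists>C. \<forall>u\<in>graph_space T0 T0'. cmod (f u) \<le> C * graph_norm T0 T0' u)}"

text \<open>Weak convergence in the graph space, i.e. against all its continuous linear functionals.\<close>

definition graph_weakly_converges ::
    "'h::complex_inner pop \<Rightarrow> 'h pop \<Rightarrow> (nat \<Rightarrow> 'h) \<Rightarrow> 'h \<Rightarrow> bool"
  where "graph_weakly_converges T0 T0' U u \<longleftrightarrow>
    (\<forall>n. U n \<in> graph_space T0 T0') \<and> u \<in> graph_space T0 T0' \<and>
    (\<forall>f\<in>graph_dual T0 T0'. (\<lambda>n. f (U n)) \<longlonglongrightarrow> f u)"

definition indef_inner :: "'h::complex_inner pop \<Rightarrow> 'h pop \<Rightarrow> 'h \<Rightarrow> 'h \<Rightarrow> complex"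
  where "indef_inner T0 T0' u v =
    cinner (op_adjoint T0' \<bullet>\<^sub>o u) v - cinner u (op_adjoint T0 \<bullet>\<^sub>o v)"

definition indef_perp :: "'h::complex_inner pop \<Rightarrow> 'h pop \<Rightarrow> 'h set \<Rightarrow> 'h set"
  where "indef_perp T0 T0' S = {u\<in>graph_space T0 T0'. \<forall>v\<in>S. indef_inner T0 T0' u v = 0}"

text \<open>
  For a joint pair \<open>indef_inner\<close> is Hermitian on the graph space, so its diagonal values are real
  and are compared through \<open>Re\<close>.
\<close>

definition condition_V :: "'h::complex_inner pop \<Rightarrow> 'h pop \<Rightarrow> 'h set \<Rightarrow> bool"
  where "condition_V T0 T0' V \<longleftrightarrow>
    V = indef_perp T0 T0' (indef_perp T0 T0' V) \<and>
    (\<forall>u\<in>V. Re (indef_inner T0 T0' u u) \<ge> 0) \<and>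
    (\<forall>v\<in>indef_perp T0 T0' V. Re (indef_inner T0 T0' v v) \<le> 0)"

end

theory Submission imports Defs begin

text \<open>
  On both \<open>V\<close> and its \<open>indef_perp\<close> the form \<open>[x | x]\<close> has a constant sign, and both sets are
  closed under differences. For a sequence \<open>x\<^sub>n\<close> in the first set with weak limit \<open>x\<close>, expanding
  \<open>[x\<^sub>n - x | x\<^sub>n - x] \<ge> 0\<close> by Hermitian symmetry gives
  \<open>[x\<^sub>n | x\<^sub>n] \<ge> 2 Re [x\<^sub>n | x] - [x | x]\<close>. The functional \<open>[\<sqdot> | x]\<close> is linear and bounded for the
  graph norm, so weak convergence sends the right-hand side to \<open>[x | x]\<close>, which is the bound on
  the lower limit. In the second set the inequalities are reversed and bound the upper limit.

  The analytic content is the Hermitian symmetry (\<open>indef_inner_hermitian\<close>). It rests on the fact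
  that \<open>T\<^sub>0 + T\<^sub>0'\<close> is bounded and symmetric on a dense domain, hence extends to an everywhere
  defined symmetric operator \<open>B\<close> (\<open>lipschitz_symmetric_extension\<close>). On the graph space this
  forces \<open>op_adjoint T\<^sub>0 u = B u - T\<^sub>1 u\<close> with \<open>T\<^sub>1 = op_adjoint T\<^sub>0'\<close>. Hence
  \<open>[u | v] = \<langle>T\<^sub>1 u | v\<rangle> + \<langle>u | T\<^sub>1 v\<rangle> - \<langle>u | B v\<rangle>\<close>: the first two terms form a Hermitian sum, and the
  last one is Hermitian because \<open>B\<close> is symmetric.
\<close>

section \<open>Complex inner products\<close>

lemma csubspace_diff:
  fixes S :: "'h::complex_inner set"
  assumes "csubspace S" "x \<in> S" "y \<in> S"
  shows "x - y \<in> S"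
  using assms module.subspace_diff[OF module_iff_vector_space[THEN iffD2, OF vector_space_scaleC]]
  by blast

lemma uminus_eq_scaleC: "- x = (-1) *\<^sub>C (x :: 'h::complex_inner)"
  using scaleR_scaleC[of "-1" x] by simp

lemma cinner_add_right: "cinner x (y + z) = cinner x y + cinner (x :: 'h::complex_inner) z"
  by (metis cinner_commute cinner_add_left complex_cnj_add)

lemma cinner_minus_left: "cinner (- x) y = - cinner (x :: 'h::complex_inner) y"
  by (simp add: uminus_eq_scaleC[of x] cinner_scaleC_left)

lemma cinner_minus_right: "cinner x (- y) = - cinner (x :: 'h::complex_inner) y"
  by (metis cinner_commute cinner_minus_left complex_cnj_minus)

lemma cinner_diff_left: "cinner (x - y) z = cinner x z - cinner (y :: 'h::complex_inner) z"
  using cinner_add_left[of x "- y" z] by (simp add: cinner_minus_left)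

lemma cinner_diff_right: "cinner x (y - z) = cinner x y - cinner (x :: 'h::complex_inner) z"
  using cinner_add_right[of x y "- z"] by (simp add: cinner_minus_right)

lemma cinner_scaleC_right: "cinner x (c *\<^sub>C y) = cnj c * cinner (x :: 'h::complex_inner) y"
  by (metis cinner_commute cinner_scaleC_left complex_cnj_mult)

lemma Re_cinner_self: "Re (cinner x x) = (norm (x :: 'h::complex_inner))\<^sup>2"
proof -
  have "sqrt (Re (cinner x x)) \<ge> 0"
    using norm_ge_zero[of x] norm_eq_sqrt_cinner[of x] by simp
  then show ?thesis
    by (simp add: norm_eq_sqrt_cinner)
qed

lemma cinner_self: "cinner x x = complex_of_real ((norm (x :: 'h::complex_inner))\<^sup>2)"
proof -
  have "Im (cinner x x) = 0"
    using arg_cong[OF cinner_commute[of x x], of Im] by simp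
  then show ?thesis
    by (simp add: complex_eq_iff Re_cinner_self)
qed

lemma norm_scaleC: "norm (c *\<^sub>C x) = cmod c * norm (x :: 'h::complex_inner)"
proof -
  have "cinner (c *\<^sub>C x) (c *\<^sub>C x) = (c * cnj c) * cinner x x"
    by (simp add: cinner_scaleC_left cinner_scaleC_right)
  also have "\<dots> = complex_of_real ((cmod c * norm x)\<^sup>2)"
    by (simp only: complex_norm_square[symmetric] cinner_self of_real_mult[symmetric]
        power_mult_distrib)
  finally have "(norm (c *\<^sub>C x))\<^sup>2 = (cmod c * norm x)\<^sup>2"
    by (simp only: cinner_self of_real_eq_iff)
  then show ?thesis
    by simp
qed

text \<open>
  The triangle inequality, being part of the class, already contains the bound on the real part:
  compare the squares of \<open>norm (x + y)\<close> and \<open>norm x + norm y\<close>. Multiplying \<open>x\<close> by a phase that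
  makes the scalar product nonnegative then yields the bound on its modulus.
\<close>
lemma cinner_Cauchy_Schwarz: "cmod (cinner x y) \<le> norm x * norm (y :: 'h::complex_inner)"
proof -
  have Re_le: "Re (cinner a b) \<le> norm a * norm b" for a b :: 'h
  proof -
    have "(norm (a + b))\<^sup>2 \<le> (norm a + norm b)\<^sup>2"
      by (intro power_mono norm_triangle_ineq norm_ge_zero)
    moreover have "(norm (a + b))\<^sup>2 = (norm a)\<^sup>2 + (norm b)\<^sup>2 + 2 * Re (cinner a b)"
      using arg_cong[OF cinner_commute[of b a], of Re]
      by (simp flip: Re_cinner_self add: cinner_add_left cinner_add_right)
    ultimately show ?thesis
      by (simp add: power2_sum)
  qed
  show ?thesis
  proof (cases "cinner x y = 0")
    case False
    define c where "c = cnj (sgn (cinner x y))"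
    have "cmod c = 1"
      using False by (simp add: c_def norm_sgn)
    have "c * cinner x y = complex_of_real (cmod (cinner x y))"
      using False by (simp add: c_def sgn_div_norm scaleR_conv_of_real field_simps
          power2_eq_square flip: complex_norm_square)
    then have "cmod (cinner x y) = Re (cinner (c *\<^sub>C x) y)"
      by (simp add: cinner_scaleC_left)
    also have "\<dots> \<le> norm (c *\<^sub>C x) * norm y"
      by (rule Re_le)
    finally show ?thesis
      by (simp add: norm_scaleC \<open>cmod c = 1\<close>)
  qed simp
qed

lemma bounded_bilinear_cinner:
  "bounded_bilinear (cinner :: 'h::complex_inner \<Rightarrow> 'h \<Rightarrow> complex)"
proof
  show "\<exists>K. \<forall>a b :: 'h. cmod (cinner a b) \<le> norm a * norm b * K"
    by (intro exI[of _ 1]) (simp add: cinner_Cauchy_Schwarz)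
qed (simp_all add: cinner_add_left cinner_add_right scaleR_scaleC[where 'a = 'h]
    cinner_scaleC_left cinner_scaleC_right scaleR_conv_of_real)

lemmas tendsto_cinner = bounded_bilinear.tendsto[OF bounded_bilinear_cinner]

section \<open>Adjoints of densely defined operators\<close>

lemma cinner_eq_on_dense:
  fixes w z :: "'h::complex_inner"
  assumes "closure D = UNIV" and eq: "\<And>x. x \<in> D \<Longrightarrow> cinner x w = cinner x z"
  shows "w = z"
proof -
  obtain s where s: "\<And>n. s n \<in> D" "s \<longlonglongrightarrow> w - z"
    using assms(1) closure_sequential[of "w - z" D] by auto
  have "(\<lambda>n. cinner (s n) (w - z)) \<longlonglongrightarrow> cinner (w - z) (w - z)"
    by (intro tendsto_cinner s tendsto_const)
  moreover have "cinner (s n) (w - z) = 0" for n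
    using eq[OF s(1)] by (simp add: cinner_diff_right)
  ultimately have "cinner (w - z) (w - z) = 0"
    by (simp add: LIMSEQ_const_iff)
  then show ?thesis
    by (simp add: cinner_self)
qed

lemma op_adjoint_eqI:
  fixes T :: "'h::complex_inner pop"
  assumes "closure (dom T) = UNIV"
    and w: "\<And>x. x \<in> dom T \<Longrightarrow> cinner (T \<bullet>\<^sub>o x) y = cinner x w"
  shows "op_adjoint T y = Some w"
proof -
  have "(THE w. \<forall>x\<in>dom T. cinner (T \<bullet>\<^sub>o x) y = cinner x w) = w"
    using w by (intro the_equality) (auto intro: cinner_eq_on_dense[OF assms(1)])
  then show ?thesis
    using w by (auto simp: op_adjoint_def)
qed

lemma cinner_op_adjoint:
  fixes T :: "'h::complex_inner pop"
  assumes "closure (dom T) = UNIV" "y \<in> dom (op_adjoint T)" "x \<in> dom T"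
  shows "cinner (T \<bullet>\<^sub>o x) y = cinner x (op_adjoint T \<bullet>\<^sub>o y)"
proof -
  obtain w where w: "\<forall>x\<in>dom T. cinner (T \<bullet>\<^sub>o x) y = cinner x w"
    using assms(2) unfolding op_adjoint_def dom_def by (simp split: if_splits) blast
  then have "op_adjoint T y = Some w"
    by (intro op_adjoint_eqI assms(1)) simp
  then show ?thesis
    using w assms(3) by simp
qed

lemma op_adjoint_add:
  fixes T :: "'h::complex_inner pop"
  assumes "closure (dom T) = UNIV" "y \<in> dom (op_adjoint T)" "z \<in> dom (op_adjoint T)"
  shows "op_adjoint T (y + z) = Some (op_adjoint T \<bullet>\<^sub>o y + op_adjoint T \<bullet>\<^sub>o z)"
  using assms by (intro op_adjoint_eqI) (simp_all add: cinner_add_right cinner_op_adjoint)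

lemma op_adjoint_scaleC:
  fixes T :: "'h::complex_inner pop"
  assumes "closure (dom T) = UNIV" "y \<in> dom (op_adjoint T)"
  shows "op_adjoint T (c *\<^sub>C y) = Some (c *\<^sub>C (op_adjoint T \<bullet>\<^sub>o y))"
  using assms by (intro op_adjoint_eqI) (simp_all add: cinner_scaleC_right cinner_op_adjoint)

section \<open>The bounded sum of a joint pair\<close>

lemma linear_operator_diff:
  assumes "linear_operator T" "x \<in> dom T" "y \<in> dom T"
  shows "T \<bullet>\<^sub>o (x - y) = T \<bullet>\<^sub>o x - T \<bullet>\<^sub>o y"
proof -
  have "x - y \<in> dom T"
    using assms csubspace_diff unfolding linear_operator_def by blast
  then have "T \<bullet>\<^sub>o ((x - y) + y) = T \<bullet>\<^sub>o (x - y) + T \<bullet>\<^sub>o y"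
    using assms unfolding linear_operator_def by blast
  then show ?thesis
    by simp
qed

text \<open>
  By completeness a Lipschitz map extends continuously from a dense set, and the symmetry passes to
  the limit because the scalar product is jointly continuous.
\<close>
lemma lipschitz_symmetric_extension:
  fixes A :: "'h::chilbert_space \<Rightarrow> 'h"
  assumes dense: "closure D = UNIV"
    and lip: "L-lipschitz_on D A"
    and sym: "\<And>x y. x \<in> D \<Longrightarrow> y \<in> D \<Longrightarrow> cinner (A x) y = cinner x (A y)"
  obtains B where "\<And>x. x \<in> D \<Longrightarrow> B x = A x" "\<And>x y. cinner (B x) y = cinner x (B y)"
proof -
  obtain B where B: "uniformly_continuous_on (closure D) B" "\<And>x. x \<in> D \<Longrightarrow> A x = B x"
    using uniformly_continuous_on_extension_on_closure[OF lipschitz_on_uniformly_continuous[OF lip]]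
    by metis
  have cont: "isCont B x" for x
    using uniformly_continuous_imp_continuous[OF B(1)] dense
    by (simp add: continuous_on_eq_continuous_at)
  have "cinner (B x) y = cinner x (B y)" for x y
  proof -
    obtain s t where s: "\<And>n. s n \<in> D" "s \<longlonglongrightarrow> x" and t: "\<And>n. t n \<in> D" "t \<longlonglongrightarrow> y"
      using dense closure_sequential[of x D] closure_sequential[of y D] by auto
    have "(\<lambda>n. cinner (B (s n)) (t n)) \<longlonglongrightarrow> cinner (B x) y"
      by (intro tendsto_cinner isCont_tendsto_compose[OF cont] s t)
    moreover have "(\<lambda>n. cinner (s n) (B (t n))) \<longlonglongrightarrow> cinner x (B y)"
      by (intro tendsto_cinner isCont_tendsto_compose[OF cont] s t)
    moreover have "cinner (B (s n)) (t n) = cinner (s n) (B (t n))" for n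
      using sym[OF s(1) t(1)] by (simp add: B(2) s(1) t(1))
    ultimately show ?thesis
      using LIMSEQ_unique by simp
  qed
  then show thesis
    using that[of B] B(2) by simp
qed

text \<open>
  The operator \<open>B\<close> is the bounded extension of \<open>T\<^sub>0 + T\<^sub>0'\<close>. For \<open>u\<close> in the graph space and \<open>x\<close> in
  the common domain,
  \<open>\<langle>T\<^sub>0 x | u\<rangle> = \<langle>B x | u\<rangle> - \<langle>T\<^sub>0' x | u\<rangle> = \<langle>x | B u - op_adjoint T\<^sub>0' u\<rangle>\<close>.
  In particular \<open>u\<close> also lies in the domain of the other adjoint.
\<close>
lemma friedrichs_adjoints_sum:
  fixes T0 T0' :: "'h::chilbert_space pop"
  assumes fp: "joint_friedrichs_pair T0 T0'"
  obtains B where "\<And>x y. cinner (B x) y = cinner x (B y)"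
    "\<And>u. u \<in> graph_space T0 T0' \<Longrightarrow> op_adjoint T0 u = Some (B u - op_adjoint T0' \<bullet>\<^sub>o u)"
proof -
  have lin: "linear_operator T0" "linear_operator T0'" and dom_eq: "dom T0' = dom T0"
    and dense: "closure (dom T0) = UNIV"
    and adj: "\<And>x y. x \<in> dom T0 \<Longrightarrow> y \<in> dom T0 \<Longrightarrow> cinner (T0 \<bullet>\<^sub>o x) y = cinner x (T0' \<bullet>\<^sub>o y)"
    using fp unfolding joint_friedrichs_pair_def by auto
  obtain l where l: "l > 0"
    "\<And>x. x \<in> dom T0 \<Longrightarrow> norm (T0 \<bullet>\<^sub>o x + T0' \<bullet>\<^sub>o x) \<le> 2 * l * norm x"
    using fp unfolding joint_friedrichs_pair_def by auto
  define A where "A x = T0 \<bullet>\<^sub>o x + T0' \<bullet>\<^sub>o x" for x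
  have "(2 * l)-lipschitz_on (dom T0) A"
  proof (rule lipschitz_onI)
    fix x y assume xy: "x \<in> dom T0" "y \<in> dom T0"
    then have "x - y \<in> dom T0"
      using lin(1) csubspace_diff unfolding linear_operator_def by blast
    moreover have "A x - A y = A (x - y)"
      using xy by (simp add: A_def linear_operator_diff lin dom_eq)
    ultimately show "dist (A x) (A y) \<le> 2 * l * dist x y"
      using l(2) by (simp add: dist_norm A_def)
  qed (use l(1) in simp)
  moreover have "cinner (A x) y = cinner x (A y)" if "x \<in> dom T0" "y \<in> dom T0" for x y
  proof -
    have "cinner (T0' \<bullet>\<^sub>o x) y = cinner x (T0 \<bullet>\<^sub>o y)"
      using adj[OF that(2,1)] by (metis cinner_commute)
    then show ?thesis
      using adj[OF that] by (simp add: A_def cinner_add_left cinner_add_right)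
  qed
  ultimately obtain B where B: "\<And>x. x \<in> dom T0 \<Longrightarrow> B x = A x"
    and sym: "\<And>x y. cinner (B x) y = cinner x (B y)"
    using lipschitz_symmetric_extension[OF dense] by metis
  have "op_adjoint T0 u = Some (B u - op_adjoint T0' \<bullet>\<^sub>o u)" if u: "u \<in> graph_space T0 T0'" for u
  proof (rule op_adjoint_eqI[OF dense])
    fix x assume x: "x \<in> dom T0"
    have "cinner (T0' \<bullet>\<^sub>o x) u = cinner x (op_adjoint T0' \<bullet>\<^sub>o u)"
      using u x dense dom_eq by (intro cinner_op_adjoint) (auto simp: graph_space_def)
    moreover have "cinner (T0 \<bullet>\<^sub>o x) u + cinner (T0' \<bullet>\<^sub>o x) u = cinner x (B u)"
      using sym[of x u] B[OF x] by (simp add: A_def cinner_add_left)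
    ultimately show "cinner (T0 \<bullet>\<^sub>o x) u = cinner x (B u - op_adjoint T0' \<bullet>\<^sub>o u)"
      by (simp add: cinner_diff_right eq_diff_eq)
  qed
  then show thesis
    using that sym by blast
qed

section \<open>The indefinite inner product\<close>

lemma indef_inner_hermitian:
  fixes T0 T0' :: "'h::chilbert_space pop"
  assumes "joint_friedrichs_pair T0 T0'" "u \<in> graph_space T0 T0'" "v \<in> graph_space T0 T0'"
  shows "indef_inner T0 T0' u v = cnj (indef_inner T0 T0' v u)"
proof -
  let ?T = "op_adjoint T0'"
  obtain B where sym: "\<And>x y. cinner (B x) y = cinner x (B y)"
    and B: "\<And>u. u \<in> graph_space T0 T0' \<Longrightarrow> op_adjoint T0 u = Some (B u - ?T \<bullet>\<^sub>o u)"
    using friedrichs_adjoints_sum[OF assms(1)] by metis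
  have "cnj (indef_inner T0 T0' v u) = cinner u (?T \<bullet>\<^sub>o v) - cinner (B u - ?T \<bullet>\<^sub>o u) v"
    using B[OF assms(2)] cinner_commute[of u "?T \<bullet>\<^sub>o v"] cinner_commute[of "op_adjoint T0 \<bullet>\<^sub>o u" v]
    by (simp add: indef_inner_def)
  then show ?thesis
    using B[OF assms(3)] sym[of u v]
    by (simp add: indef_inner_def cinner_diff_left cinner_diff_right)
qed

lemma friedrichs_dense:
  assumes "joint_friedrichs_pair T0 T0'"
  shows "closure (dom T0') = UNIV"
  using assms by (auto simp: joint_friedrichs_pair_def)

lemma csubspace_graph_space:
  assumes "joint_friedrichs_pair T0 T0'"
  shows "csubspace (graph_space T0 T0')"
proof -
  note dense = friedrichs_dense[OF assms]
  have "op_adjoint T0' 0 = Some 0"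
    by (rule op_adjoint_eqI[OF dense])
      (metis add_0 cinner_add_right add_cancel_right_left)
  then show ?thesis
    unfolding module.subspace_def[OF module_iff_vector_space[THEN iffD2, OF vector_space_scaleC]]
    by (auto simp: graph_space_def domIff op_adjoint_add[OF dense] op_adjoint_scaleC[OF dense])
qed

lemma indef_inner_add_left:
  assumes "joint_friedrichs_pair T0 T0'" "x \<in> graph_space T0 T0'" "y \<in> graph_space T0 T0'"
  shows "indef_inner T0 T0' (x + y) z = indef_inner T0 T0' x z + indef_inner T0 T0' y z"
  using op_adjoint_add[OF friedrichs_dense[OF assms(1)] assms(2,3)[unfolded graph_space_def]]
  by (simp add: indef_inner_def cinner_add_left)

lemma indef_inner_scaleC_left:
  assumes "joint_friedrichs_pair T0 T0'" "x \<in> graph_space T0 T0'"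
  shows "indef_inner T0 T0' (c *\<^sub>C x) z = c * indef_inner T0 T0' x z"
  using op_adjoint_scaleC[OF friedrichs_dense[OF assms(1)] assms(2)[unfolded graph_space_def]]
  by (simp add: indef_inner_def cinner_scaleC_left right_diff_distrib)

lemma indef_inner_diff_left:
  assumes "joint_friedrichs_pair T0 T0'" "x \<in> graph_space T0 T0'" "y \<in> graph_space T0 T0'"
  shows "indef_inner T0 T0' (x - y) z = indef_inner T0 T0' x z - indef_inner T0 T0' y z"
  using indef_inner_add_left[OF assms(1) csubspace_diff[OF csubspace_graph_space assms(2,3)] assms(3)]
    assms(1) by (simp add: eq_diff_eq)

lemma Re_indef_inner_diff_self:
  fixes T0 T0' :: "'h::chilbert_space pop"
  assumes "joint_friedrichs_pair T0 T0'" "x \<in> graph_space T0 T0'" "y \<in> graph_space T0 T0'"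
  shows "Re (indef_inner T0 T0' (x - y) (x - y)) =
    Re (indef_inner T0 T0' x x) - (2 * Re (indef_inner T0 T0' x y) - Re (indef_inner T0 T0' y y))"
proof -
  note diff = indef_inner_diff_left[OF assms]
  have d: "x - y \<in> graph_space T0 T0'"
    using assms by (intro csubspace_diff csubspace_graph_space)
  have sym: "Re (indef_inner T0 T0' a b) = Re (indef_inner T0 T0' b a)"
    if "a \<in> graph_space T0 T0'" "b \<in> graph_space T0 T0'" for a b
    using indef_inner_hermitian[OF assms(1) that] by simp
  show ?thesis
    using diff[of "x - y"] diff[of x] diff[of y] sym[OF assms(2) d] sym[OF assms(3) d]
      sym[OF assms(2,3)] by simp
qed

section \<open>Weak semicontinuity\<close>

text \<open>Boundedness comes from the Cauchy--Schwarz inequality applied to both terms of the form.\<close>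
lemma indef_inner_in_graph_dual:
  assumes "joint_friedrichs_pair T0 T0'"
  shows "(\<lambda>x. indef_inner T0 T0' x y) \<in> graph_dual T0 T0'"
proof -
  let ?N = "norm y + norm (op_adjoint T0 \<bullet>\<^sub>o y)"
  have "cmod (indef_inner T0 T0' x y) \<le> ?N * graph_norm T0 T0' x" for x
  proof -
    let ?Tx = "op_adjoint T0' \<bullet>\<^sub>o x"
    have "cmod (indef_inner T0 T0' x y) \<le> norm ?Tx * norm y + norm x * norm (op_adjoint T0 \<bullet>\<^sub>o y)"
      unfolding indef_inner_def
      by (intro order_trans[OF norm_triangle_ineq4] add_mono cinner_Cauchy_Schwarz)
    also have "\<dots> \<le> ?N * graph_norm T0 T0' x"
      by (simp add: graph_norm_def algebra_simps)
    finally show ?thesis .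
  qed
  then show ?thesis
    using indef_inner_add_left[OF assms] indef_inner_scaleC_left[OF assms]
    unfolding graph_dual_def by blast
qed

text \<open>
  The sequence below is the lower or upper bound for \<open>[x\<^sub>n | x\<^sub>n]\<close> obtained from the sign of
  \<open>[x\<^sub>n - x | x\<^sub>n - x]\<close>.
\<close>
lemma graph_weakly_converges_tendsto_indef_inner:
  assumes "joint_friedrichs_pair T0 T0'" "graph_weakly_converges T0 T0' X x"
  shows "(\<lambda>n. ereal (2 * Re (indef_inner T0 T0' (X n) x) - Re (indef_inner T0 T0' x x)))
    \<longlonglongrightarrow> ereal (Re (indef_inner T0 T0' x x))"
proof -
  have "(\<lambda>n. indef_inner T0 T0' (X n) x) \<longlonglongrightarrow> indef_inner T0 T0' x x"
    using assms(2) indef_inner_in_graph_dual[OF assms(1)]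
    unfolding graph_weakly_converges_def by fast
  then have "(\<lambda>n. 2 * Re (indef_inner T0 T0' (X n) x) - Re (indef_inner T0 T0' x x))
      \<longlonglongrightarrow> 2 * Re (indef_inner T0 T0' x x) - Re (indef_inner T0 T0' x x)"
    by (intro tendsto_intros)
  then show ?thesis
    by simp
qed

lemma indef_perp_diff:
  assumes "joint_friedrichs_pair T0 T0'" "x \<in> indef_perp T0 T0' S" "y \<in> indef_perp T0 T0' S"
  shows "x - y \<in> indef_perp T0 T0' S"
  using assms csubspace_diff[OF csubspace_graph_space[OF assms(1)]]
  by (auto simp: indef_perp_def indef_inner_diff_left)

theorem theorem3p1:
  fixes T0 T0' :: "'h::chilbert_space pop" and V :: "'h set"
    and U W :: "nat \<Rightarrow> 'h" and u v :: 'h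
  assumes "joint_friedrichs_pair T0 T0'"
    and "csubspace V" and "V \<subseteq> graph_space T0 T0'"
    and "condition_V T0 T0' V"
    and "\<And>n. U n \<in> V" and "u \<in> V"
    and "graph_weakly_converges T0 T0' U u"
    and "\<And>n. W n \<in> indef_perp T0 T0' V" and "v \<in> indef_perp T0 T0' V"
    and "graph_weakly_converges T0 T0' W v"
  shows "liminf (\<lambda>n. ereal (Re (indef_inner T0 T0' (U n) (U n)))) \<ge> ereal (Re (indef_inner T0 T0' u u))
    \<and> limsup (\<lambda>n. ereal (Re (indef_inner T0 T0' (W n) (W n)))) \<le> ereal (Re (indef_inner T0 T0' v v))"
proof
  note fp = assms(1)
  note weak_U = assms(7) and weak_W = assms(10)
  have graph: "U n \<in> graph_space T0 T0'" "u \<in> graph_space T0 T0'"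
    "W n \<in> graph_space T0 T0'" "v \<in> graph_space T0 T0'" for n
    using weak_U weak_W by (auto simp: graph_weakly_converges_def)
  have nonneg: "Re (indef_inner T0 T0' x x) \<ge> 0" if "x \<in> V" for x
    using assms(4) that by (simp add: condition_V_def)
  have nonpos: "Re (indef_inner T0 T0' x x) \<le> 0" if "x \<in> indef_perp T0 T0' V" for x
    using assms(4) that by (simp add: condition_V_def)

  let ?a = "\<lambda>n. 2 * Re (indef_inner T0 T0' (U n) u) - Re (indef_inner T0 T0' u u)"
  have "?a n \<le> Re (indef_inner T0 T0' (U n) (U n))" for n
    using nonneg[OF csubspace_diff[OF assms(2,5,6)], of n]
      Re_indef_inner_diff_self[OF fp graph(1,2), of n] by simp
  then have "liminf (\<lambda>n. ereal (?a n)) \<le> liminf (\<lambda>n. ereal (Re (indef_inner T0 T0' (U n) (U n))))"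
    by (intro Liminf_mono always_eventually allI) simp
  then show "liminf (\<lambda>n. ereal (Re (indef_inner T0 T0' (U n) (U n))))
      \<ge> ereal (Re (indef_inner T0 T0' u u))"
    using lim_imp_Liminf[OF sequentially_bot graph_weakly_converges_tendsto_indef_inner[OF fp weak_U]]
    by simp

  let ?b = "\<lambda>n. 2 * Re (indef_inner T0 T0' (W n) v) - Re (indef_inner T0 T0' v v)"
  have "Re (indef_inner T0 T0' (W n) (W n)) \<le> ?b n" for n
    using nonpos[OF indef_perp_diff[OF fp assms(8,9)], of n]
      Re_indef_inner_diff_self[OF fp graph(3,4), of n] by simp
  then have "limsup (\<lambda>n. ereal (Re (indef_inner T0 T0' (W n) (W n)))) \<le> limsup (\<lambda>n. ereal (?b n))"
    by (intro Limsup_mono always_eventually allI) simp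
  then show "limsup (\<lambda>n. ereal (Re (indef_inner T0 T0' (W n) (W n))))
      \<le> ereal (Re (indef_inner T0 T0' v v))"
    using lim_imp_Limsup[OF sequentially_bot graph_weakly_converges_tendsto_indef_inner[OF fp weak_W]]
    by simp
qed

end
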